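(* One has $$\lim_{\lambda\to2^+}\mathcal{T}_{\mathbb{R}}(\Omega_\lambda)=2<3=\lim_{\lambda\to2^-}\mathcal{T}_{\mathbb{R}}(\Omega_\lambda).$$ In particular, the function $\lambda\mapsto\mathcal{T}_{\mathbb{R}}(\Omega_\lambda)$ is not continuous at $\lambda=2$.
   Context: For $\lambda\ge 0$ let $\Omega_\lambda=(-1,1)\cup(\lambda-1,\lambda+1)\cup(-\lambda-1,-\lambda+1)\subset\mathbb{R}$. A function $f:\mathbb{R}\to\mathbb{C}$ is positive definite if $\sum_{j,k=1}^m z_j\overline{z_k}f(x_j-x_k)\ge 0$ for all finite choices of $x_1,\dots,x_m\in\mathbb{R}$ and $z_1,\dots,z_m\in\mathbb{C}$. For an open bounded set $\Omega\subset\mathbb{R}$ with $\Omega=-\Omega$ and $0\in\Omega$, the Turán constant is $$\mathcal{T}_{\mathbb{R}}(\Omega)=\sup\left\{\int_{\mathbb{R}}f(x)\,dx: f\in C(\mathbb{R}),\ f \text{ positive definite},\ f(0)=1,\ \operatorname{supp} f\subset\Omega\right\},$$ where $\operatorname{supp} f$ is the closed support of $f$ (the integrals in question are automatically real). *)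

theory Defs
  imports "HOL-Analysis.Analysis"
begin

definition Omega :: "real \<Rightarrow> real set" where
  "Omega t = {-1<..<1} \<union> {t - 1<..<t + 1} \<union> {-t - 1<..<-t + 1}"

text \<open>Membership in the nonnegative reals includes that the complex sum is real.\<close>

definition positive_definite :: "(real \<Rightarrow> complex) \<Rightarrow> bool" where
  "positive_definite f \<longleftrightarrow>
     (\<forall>(m::nat) (x :: nat \<Rightarrow> real) (z :: nat \<Rightarrow> complex).
        (\<Sum>j<m. \<Sum>k<m. z j * cnj (z k) * f (x j - x k)) \<in> \<real>\<^sub>\<ge>\<^sub>0)"

definition turan_admissible :: "real set \<Rightarrow> (real \<Rightarrow> complex) \<Rightarrow> bool" where
  "turan_admissible \<Omega> f \<longleftrightarrow>
     continuous_on UNIV f \<and> positive_definite f \<and> f 0 = 1 \<and> closure {x. f x \<noteq> 0} \<subseteq> \<Omega>"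

text \<open>Only meaningful for an open, bounded, symmetric set containing 0. In that case the set below
  is nonempty, and it is bounded above because positive definiteness and \<open>f 0 = 1\<close> give
  \<open>cmod (f x) \<le> 1\<close>, so the supremum in the reals is the true one. A positive definite \<open>f\<close> satisfies
  \<open>f (- x) = cnj (f x)\<close>, so the integral is real and taking its real part loses nothing.\<close>

definition turan_constant :: "real set \<Rightarrow> real" where
  "turan_constant \<Omega> = Sup {Re (LINT x|lborel. f x) | f. turan_admissible \<Omega> f}"

end

theory Submission
  imports Defs
begin

text \<open>
  For \<open>0 \<le> t < 2\<close> the set \<open>Omega t\<close> is the interval \<open>(-1-t, 1+t)\<close>, whose Turan constant is
  half its length. As soon as \<open>t > 2\<close>, gaps open at distance about 1 from the origin, and
  the constant is squeezed between 2 and \<open>t\<close>. The limits 3 from the left and 2 from the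
  right follow.

  Upper bounds come from packings. Suppose a set \<open>A\<close> of reals is periodic with period \<open>L\<close> and has
  \<open>m\<close> points per period, and no difference of two distinct points of \<open>A\<close> lies in \<open>\<Omega>\<close>.
  Integrating an admissible \<open>f\<close> against the autocorrelation of
  (counting measure of \<open>A\<close>) minus \<open>m/L\<close> times (Lebesgue measure), which is a positive
  definite measure, gives \<open>m f(0) - (m\<^sup>2/L) \<integral> f \<ge> 0\<close> per period, that is \<open>\<integral> f \<le> L/m\<close>.
  The argument is carried out on a grid of mesh \<open>L/n\<close>, where the measures are weighted sums
  (\<open>packing_bound_sequence\<close>), and the integral returns as a limit of Riemann sums
  (\<open>turan_integral_le_packing\<close>). For \<open>t < 2\<close> the packing is \<open>(1+t)\<int>\<close>. For \<open>t > 2\<close> it consists of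
  pairs of points at distance between 1 and \<open>t - 1\<close>, repeated with period \<open>2t\<close>: the gap
  \<open>[1, t - 1]\<close> makes room for one point per length \<open>t\<close> on average, instead of one per length \<open>1 + t\<close>.

  Lower bounds come from triangle functions, which are positive definite because they are
  autocorrelations of intervals. For \<open>t < 2\<close> one wide triangle fills the interval. For \<open>t > 2\<close>
  a triangle of half-width \<open>r < 1\<close> at the origin together with two copies of half the height
  at \<open>\<plusminus>t\<close>, which is the normalised autocorrelation of a pair of intervals, has integral \<open>2r\<close>.
\<close>

section \<open>Positive definite sequences and periodic weights\<close>

text \<open>
  The form given by \<open>c\<close> is nonnegative on the restriction of \<open>u\<close> to any window of \<open>M\<close> periods.
  Truncation to the window only affects the rows within distance \<open>K\<close> of its two
  ends, so it changes the form by an amount bounded independently of \<open>M\<close>, whereas the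
  untruncated form is \<open>M\<close> times the sum over one period.
\<close>

lemma periodic_form_nonneg:
  fixes c u :: "int \<Rightarrow> real" and K n :: nat
  assumes pd: "\<And>N (v :: nat \<Rightarrow> real). 0 \<le> (\<Sum>j<N. \<Sum>k<N. v j * v k * c (int j - int k))"
    and supp: "\<And>d. int K < \<bar>d\<bar> \<Longrightarrow> c d = 0"
    and per: "\<And>x. u (x + int n) = u x"
    and bound: "\<And>x. \<bar>u x\<bar> \<le> B"
  shows "0 \<le> (\<Sum>j<n. \<Sum>d\<in>{-int K..int K}. c d * u (int j) * u (int j - d))"
proof -
  define G where "G j d = c d * u (int j) * u (int j - d)" for j d
  define D where "D = {- int K..int K}"
  define W where "W j = (\<Sum>d\<in>D. G j d)" for j
  define C where "C = (\<Sum>d\<in>D. \<bar>c d\<bar> * B * B)"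
  have B0: "0 \<le> B" using bound[of 0] by linarith
  have G_bound: "\<bar>G j d\<bar> \<le> \<bar>c d\<bar> * B * B" for j d
    unfolding G_def abs_mult using B0 bound by (intro mult_mono) auto
  have G_zero: "G j d = 0" if "d \<notin> D" for j d
    using supp[of d] that unfolding G_def D_def by force
  have C0: "0 \<le> C" unfolding C_def using B0 by (intro sum_nonneg) auto
  have W_per: "W (j + n) = W j" for j
  proof -
    have "u (int (j + n)) = u (int j)" "u (int (j + n) - d) = u (int j - d)" for d
      using per[of "int j"] per[of "int j - d"] by (simp_all add: algebra_simps)
    then show ?thesis unfolding W_def G_def by simp
  qed
  have W_per': "W (j + i * n) = W j" for i j
  proof (induction i)
    case (Suc i)
    have "j + Suc i * n = (j + i * n) + n" by simp
    then show ?case using Suc W_per by metis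
  qed simp
  have W_sum: "(\<Sum>j<M * n. W j) = real M * (\<Sum>j<n. W j)" for M
  proof -
    have block: "(\<Sum>j\<in>{i * n..<i * n + n}. W j) = (\<Sum>j<n. W (j + i * n))" for i
      by (rule sum.reindex_bij_witness[of _ "\<lambda>j. j + i * n" "\<lambda>j. j - i * n"]) auto
    have "(\<Sum>j<M * n. W j) = (\<Sum>i<M. \<Sum>j\<in>{i * n..<i * n + n}. W j)"
      by (simp add: sum.nat_group)
    also have "\<dots> = (\<Sum>i<M. \<Sum>j<n. W (j + i * n))"
      by (intro sum.cong refl block)
    finally show ?thesis by (simp add: W_per')
  qed
  have main: "0 \<le> real M * (\<Sum>j<n. W j) + 2 * real K * C" for M
  proof -
    define N where "N = M * n"
    define I where "I j = (\<lambda>k. int j - int k) ` {..<N}" for j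
    define E where "E j = (\<Sum>k<N. u (int j) * u (int k) * c (int j - int k))" for j
    define bad where "bad = {..<K} \<union> {N - K..<N}"
    have card_bad: "card bad \<le> 2 * K"
      using card_Un_le[of "{..<K}" "{N - K..<N}"] unfolding bad_def by auto
    have E_eq: "E j = (\<Sum>d\<in>I j. G j d)" for j
      unfolding E_def I_def G_def by (subst sum.reindex) (auto simp: inj_on_def algebra_simps)
    have fin: "finite (I j)" "finite D" for j unfolding I_def D_def by auto
    have E_eq': "E j = (\<Sum>d\<in>I j \<inter> D. G j d)" for j
      unfolding E_eq by (rule sum.mono_neutral_right) (use fin G_zero in auto)
    have diff: "W j - E j = (\<Sum>d\<in>D - I j. G j d)" for j
      using sum.Int_Diff[OF fin(2), of "G j" "I j"] unfolding W_def E_eq' by (simp add: Int_commute)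
    have "E j \<le> W j + (if j \<in> bad then C else 0)" if "j < N" for j
    proof (cases "j \<in> bad")
      case True
      have "\<bar>W j - E j\<bar> \<le> (\<Sum>d\<in>D - I j. \<bar>G j d\<bar>)" unfolding diff by (rule sum_abs)
      also have "\<dots> \<le> (\<Sum>d\<in>D. \<bar>G j d\<bar>)" using fin by (intro sum_mono2) auto
      also have "\<dots> \<le> C" unfolding C_def by (intro sum_mono G_bound)
      finally show ?thesis using True by simp
    next
      case False
      have "d \<in> I j" if "d \<in> D" for d
      proof -
        have "d = int j - int (nat (int j - d))" "nat (int j - d) < N"
          using that False \<open>j < N\<close> unfolding D_def bad_def by auto
        then show ?thesis unfolding I_def by blast
      qed
      then have empty: "D - I j = {}" by auto
      then show ?thesis using diff[of j] False unfolding empty by simp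
    qed
    then have "(\<Sum>j<N. E j) \<le> (\<Sum>j<N. W j + (if j \<in> bad then C else 0))"
      by (intro sum_mono) simp
    also have "\<dots> = (\<Sum>j<N. W j) + (\<Sum>j\<in>{..<N} \<inter> bad. C)"
      by (simp only: sum.distrib sum.inter_restrict finite_lessThan)
    also have "(\<Sum>j\<in>{..<N} \<inter> bad. C) \<le> 2 * real K * C"
    proof -
      have "card ({..<N} \<inter> bad) \<le> card bad" by (rule card_mono) (auto simp: bad_def)
      then have "real (card ({..<N} \<inter> bad)) \<le> 2 * real K" using card_bad by linarith
      then show ?thesis using C0 by (simp add: mult_right_mono)
    qed
    also have "(\<Sum>j<N. W j) = real M * (\<Sum>j<n. W j)" unfolding N_def by (rule W_sum)
    finally show ?thesis
      using pd[where v = "\<lambda>j. u (int j)" and N = N] unfolding E_def by linarith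
  qed
  have "0 \<le> (\<Sum>j<n. W j)"
  proof (rule ccontr)
    assume "\<not> 0 \<le> (\<Sum>j<n. W j)"
    then have neg: "0 < - (\<Sum>j<n. W j)" by simp
    obtain M :: nat where "2 * real K * C < real M * (- (\<Sum>j<n. W j))"
      using reals_Archimedean3[OF neg] by blast
    then show False using main[of M] by simp
  qed
  then show ?thesis unfolding W_def G_def D_def .
qed

text \<open>
  The weight is the indicator of the residue set \<open>F\<close> minus its mean \<open>a = |F|/n\<close>. The packing
  condition reduces the indicator-indicator term of the form to the diagonal contribution
  \<open>|F| * c 0\<close>, and the other three terms add up to \<open>-a * |F|\<close> times the sum of \<open>c\<close>.
\<close>

lemma packing_bound_sequence:
  fixes c :: "int \<Rightarrow> real" and K n :: nat
  assumes pd: "\<And>N (v :: nat \<Rightarrow> real). 0 \<le> (\<Sum>j<N. \<Sum>k<N. v j * v k * c (int j - int k))"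
    and supp: "\<And>d. int K < \<bar>d\<bar> \<Longrightarrow> c d = 0"
    and F: "F \<subseteq> {0..<int n}" "F \<noteq> {}"
    and pack: "\<And>x y. x mod int n \<in> F \<Longrightarrow> y mod int n \<in> F \<Longrightarrow> x \<noteq> y \<Longrightarrow> c (x - y) = 0"
  shows "real (card F) * (\<Sum>d\<in>{-int K..int K}. c d) \<le> real n * c 0"
proof -
  define chi :: "int \<Rightarrow> real" where "chi x = (if x mod int n \<in> F then 1 else 0)" for x
  define P where "P = (\<Sum>d\<in>{-int K..int K}. c d)"
  define m where "m = real (card F)"
  define a where "a = m / real n"
  have n: "n > 0" using F by (cases n) auto
  have finF: "finite F" using F finite_subset by blast
  have m: "m > 0" unfolding m_def using F finF by (simp add: card_gt_0_iff)
  have mass: "(\<Sum>j<n. chi (int j - d)) = m" for d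
  proof -
    have "(\<Sum>j<n. chi (int j - d)) = (\<Sum>i\<in>{0..<int n}. if i \<in> F then 1 else 0)"
      by (rule sum.reindex_bij_witness[of _ "\<lambda>i. nat ((i + d) mod int n)" "\<lambda>j. (int j - d) mod int n"])
         (use n in \<open>auto simp: chi_def mod_simps nat_less_iff\<close>)
    also have "\<dots> = m" unfolding m_def using F
      by (simp add: sum.inter_restrict[symmetric] Int_absorb1)
    finally show ?thesis .
  qed
  have diag: "(\<Sum>d\<in>{-int K..int K}. c d * chi (int j) * chi (int j - d)) = c 0 * chi (int j)" for j
  proof -
    have "(\<Sum>d\<in>{-int K..int K}. c d * chi (int j) * chi (int j - d))
        = (\<Sum>d\<in>{0}. c d * chi (int j) * chi (int j - d))"
    proof (rule sum.mono_neutral_right)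
      show "\<forall>d\<in>{-int K..int K} - {0}. c d * chi (int j) * chi (int j - d) = 0"
        using pack[of "int j" "int j - d" for d] by (auto simp: chi_def)
    qed auto
    then show ?thesis by (simp add: chi_def)
  qed
  have "0 \<le> (\<Sum>j<n. \<Sum>d\<in>{-int K..int K}. c d * (chi (int j) - a) * (chi (int j - d) - a))"
    by (rule periodic_form_nonneg[OF pd supp, where u = "\<lambda>x. chi x - a" and B = "1 + \<bar>a\<bar>"])
       (auto simp: chi_def)
  also have "\<dots> = (\<Sum>j<n. \<Sum>d\<in>{-int K..int K}. c d * chi (int j) * chi (int j - d)
       - a * (c d * chi (int j)) - a * (c d * chi (int j - d)) + a * a * c d)"
    by (simp add: algebra_simps)
  also have "\<dots> = c 0 * (\<Sum>j<n. chi (int j)) - a * (P * (\<Sum>j<n. chi (int j)))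
       - a * (\<Sum>j<n. \<Sum>d\<in>{-int K..int K}. c d * chi (int j - d)) + real n * (a * a * P)"
    by (simp add: sum.distrib sum_subtractf diag sum_distrib_left[symmetric]
        sum_distrib_right[symmetric] P_def)
  also have "(\<Sum>j<n. \<Sum>d\<in>{-int K..int K}. c d * chi (int j - d)) = P * m"
    by (subst sum.swap) (simp add: sum_distrib_left[symmetric] mass P_def sum_distrib_right[symmetric])
  also have "(\<Sum>j<n. chi (int j)) = m" using mass[of 0] by simp
  also have "real n * (a * a * P) = a * (P * m)" unfolding a_def using n by simp
  finally have "0 \<le> m * (c 0 - a * P)" by (simp add: algebra_simps)
  then have "a * P \<le> c 0" using m by (simp add: zero_le_mult_iff)
  then show ?thesis unfolding a_def m_def P_def using n by (simp add: field_simps)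
qed

section \<open>From sequences to functions on the line\<close>

text \<open>
  On each subinterval the increment of the antiderivative is the mesh times a value of \<open>g\<close> at an
  intermediate point, by the mean value theorem; uniform continuity compares this value with
  the one at the left endpoint, and the increments telescope.
\<close>

lemma riemann_sums_tendsto_integral:
  fixes g :: "real \<Rightarrow> real"
  assumes cont: "continuous_on {a..b} g" and "a \<le> b"
  shows "(\<lambda>N. (b - a) / real N * (\<Sum>i<N. g (a + real i * ((b - a) / real N))))
           \<longlonglongrightarrow> integral {a..b} g"
proof (rule LIMSEQ_I)
  fix e :: real assume e: "0 < e"
  define G where "G x = integral {a..x} g" for x
  define e' where "e' = e / (b - a + 1)"
  have e': "0 < e'" "(b - a) * e' < e" unfolding e'_def using e \<open>a \<le> b\<close> by (auto simp: field_simps)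
  have "uniformly_continuous_on {a..b} g" using cont by (intro compact_uniformly_continuous) auto
  then obtain \<delta> where \<delta>: "\<delta> > 0"
    "\<And>x y. x \<in> {a..b} \<Longrightarrow> y \<in> {a..b} \<Longrightarrow> dist y x < \<delta> \<Longrightarrow> dist (g y) (g x) < e'"
    unfolding uniformly_continuous_on_def using e'(1) by metis
  have G_deriv: "(G has_real_derivative g x) (at x within {a..b})" if "x \<in> {a..b}" for x
    unfolding G_def using integral_has_real_derivative[OF cont that] .
  obtain N0 :: nat where N0: "(b - a) / \<delta> < real N0" using reals_Archimedean2 by blast
  have "norm ((b - a) / real N * (\<Sum>i<N. g (a + real i * ((b - a) / real N))) - integral {a..b} g) < e"
    if N: "N \<ge> Suc N0" for N
  proof -
    define h where "h = (b - a) / real N"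
    define x where "x i = a + real i * h" for i
    have Npos: "real N > 0" using N by simp
    have h0: "0 \<le> h" unfolding h_def using \<open>a \<le> b\<close> by simp
    have Nh: "real N * h = b - a" unfolding h_def using Npos by simp
    have h\<delta>: "h < \<delta>"
    proof -
      have "(b - a) / \<delta> < real N" using N N0 by linarith
      then show ?thesis unfolding h_def using \<delta>(1) Npos by (simp add: field_simps)
    qed
    have x_in: "x i \<in> {a..b}" if "i \<le> N" for i
    proof -
      have "real i * h \<le> real N * h" using that h0 by (intro mult_right_mono) auto
      then show ?thesis unfolding x_def using h0 Nh by auto
    qed
    have step: "\<bar>h * g (x i) - (G (x (Suc i)) - G (x i))\<bar> \<le> h * e'" if "i < N" for i
    proof (cases "h = 0")
      case True then show ?thesis by (simp add: x_def)
    next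
      case False
      have lt: "x i < x (Suc i)" "x (Suc i) - x i = h" unfolding x_def using False h0
        by (auto simp: algebra_simps)
      have sub: "{x i..x (Suc i)} \<subseteq> {a..b}" using x_in[of i] x_in[of "Suc i"] that by auto
      have "\<exists>z\<in>{x i<..<x (Suc i)}. G (x (Suc i)) - G (x i) = (x (Suc i) - x i) * g z"
      proof (rule mvt_simple[of "x i" "x (Suc i)" G "\<lambda>z t. t * g z", simplified])
        show "x i < x (Suc i)" by (rule lt)
        show "(G has_derivative (\<lambda>t. t * g z)) (at z within {x i..x (Suc i)})"
          if "x i \<le> z" "z \<le> x (Suc i)" for z
          using DERIV_subset[OF G_deriv[of z] sub] sub that
          by (auto simp: has_field_derivative_def mult_commute_abs)
      qed
      then obtain z where z: "x i < z" "z < x (Suc i)" "G (x (Suc i)) - G (x i) = h * g z"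
        using lt by auto
      have "dist (g z) (g (x i)) < e'"
        using z lt sub h\<delta> by (intro \<delta>(2)) (auto simp: dist_real_def)
      then have "h * \<bar>g (x i) - g z\<bar> \<le> h * e'"
        using h0 by (intro mult_left_mono) (auto simp: dist_real_def)
      then show ?thesis unfolding z(3) using h0
        by (simp add: right_diff_distrib[symmetric] abs_mult)
    qed
    have "integral {a..b} g = G (x N) - G (x 0)" unfolding x_def using Nh by (simp add: G_def)
    also have "\<dots> = (\<Sum>i<N. G (x (Suc i)) - G (x i))" by (rule sum_lessThan_telescope[symmetric])
    finally have "h * (\<Sum>i<N. g (x i)) - integral {a..b} g
        = (\<Sum>i<N. h * g (x i) - (G (x (Suc i)) - G (x i)))"
      by (simp add: sum_subtractf sum_distrib_left)
    also have "\<bar>\<dots>\<bar> \<le> (\<Sum>i<N. h * e')"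
      by (intro order_trans[OF sum_abs] sum_mono step) simp
    also have "\<dots> = (b - a) * e'" using Nh by (simp add: mult.assoc[symmetric])
    also have "\<dots> < e" by (rule e')
    finally show ?thesis by (simp add: h_def x_def)
  qed
  then show "\<exists>no. \<forall>N\<ge>no. norm ((b - a) / real N * (\<Sum>i<N. g (a + real i * ((b - a) / real N)))
      - integral {a..b} g) < e"
    by blast
qed

lemma compactly_supported_lborel:
  fixes f :: "real \<Rightarrow> 'a :: euclidean_space"
  assumes cont: "continuous_on UNIV f" and zero: "\<And>x. x \<notin> {a..b} \<Longrightarrow> f x = 0"
  shows "integrable lborel f" "(LINT x|lborel. f x) = integral {a..b} f"
proof -
  have eq: "(\<lambda>x. indicator {a..b} x *\<^sub>R f x) = f"
    using zero by (force simp: indicator_def)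
  have si: "set_integrable lborel {a..b} f"
    using cont continuous_on_subset by (intro borel_integrable_atLeastAtMost') blast
  from si show "integrable lborel f" unfolding set_integrable_def eq .
  from set_borel_integral_eq_integral(2)[OF si] show "(LINT x|lborel. f x) = integral {a..b} f"
    unfolding set_lebesgue_integral_def eq .
qed

lemma positive_definite_real_form:
  fixes v x :: "nat \<Rightarrow> real"
  assumes "positive_definite f"
  shows "0 \<le> (\<Sum>j<m. \<Sum>k<m. v j * v k * Re (f (x j - x k)))"
proof -
  have "(\<Sum>j<m. \<Sum>k<m. complex_of_real (v j) * cnj (complex_of_real (v k)) * f (x j - x k)) \<in> \<real>\<^sub>\<ge>\<^sub>0"
    using assms[unfolded positive_definite_def, rule_format, where z = "\<lambda>j. complex_of_real (v j)"] .
  then have "0 \<le> Re (\<Sum>j<m. \<Sum>k<m. complex_of_real (v j) * cnj (complex_of_real (v k)) * f (x j - x k))"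
    using complex_nonneg_Reals_iff by blast
  then show ?thesis by (simp flip: of_real_mult)
qed

text \<open>
  \<open>F\<close> describes the packing on the grid of mesh \<open>L/n\<close>, and the bound for sequences applies to the
  samples of \<open>Re f\<close> on that grid. The packing may vary with \<open>n\<close>, so that a packing whose
  distances are incommensurable with \<open>L\<close> may be approximated.
\<close>

lemma turan_integral_le_packing:
  assumes adm: "turan_admissible \<Omega> f" and bdd: "\<Omega> \<subseteq> {-R<..<R}" and L: "0 < L" and m: "0 < m"
    and pack: "\<forall>\<^sub>F n in sequentially. \<exists>F. F \<subseteq> {0..<int n} \<and> card F = m \<and>
      (\<forall>x y. x mod int n \<in> F \<longrightarrow> y mod int n \<in> F \<longrightarrow> x \<noteq> y \<longrightarrow>
         of_int (x - y) * (L / real n) \<notin> \<Omega>)"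
  shows "Re (LINT x|lborel. f x) \<le> L / real m"
proof -
  define g where "g x = Re (f x)" for x
  have cont_f: "continuous_on UNIV f" and pd: "positive_definite f" and f0: "f 0 = 1"
    using adm unfolding turan_admissible_def by auto
  have f_zero: "f x = 0" if "x \<notin> \<Omega>" for x
    using adm that closure_subset[of "{x. f x \<noteq> 0}"] unfolding turan_admissible_def by auto
  have cont_g: "continuous_on UNIV g" unfolding g_def using cont_f by (intro continuous_intros)
  obtain q0 :: nat where q0: "R < real q0 * L" using reals_Archimedean3[OF L] by blast
  \<comment> \<open>The grid of mesh \<open>L/n\<close> subdivides \<open>[-q*L, q*L]\<close> exactly, and \<open>f\<close> vanishes outside it.\<close>
  define q where "q = Suc q0"
  have qR: "R < real q * L" and q: "q > 0" using q0 L unfolding q_def by (auto simp: algebra_simps)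
  have g_zero: "g x = 0" if "real q * L \<le> \<bar>x\<bar>" for x
    unfolding g_def using f_zero[of x] bdd that qR by force
  have f_zero': "f x = 0" if "x \<notin> {- (real q * L)..real q * L}" for x
    using f_zero[of x] bdd that qR by force
  have "Re (LINT x|lborel. f x) = (LINT x|lborel. g x)"
    unfolding g_def using compactly_supported_lborel(1)[OF cont_f f_zero'] by simp
  also have "\<dots> = integral {- (real q * L)..real q * L} g"
    by (rule compactly_supported_lborel(2)[OF cont_g]) (use g_zero in force)
  finally have int_eq: "Re (LINT x|lborel. f x) = integral {- (real q * L)..real q * L} g" .
  have lim: "(\<lambda>n. L / real n * (\<Sum>d\<in>{-int (q * n)..int (q * n)}. g (of_int d * (L / real n))))
      \<longlonglongrightarrow> integral {- (real q * L)..real q * L} g"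
  proof (rule Lim_transform_eventually)
    have mono: "strict_mono (\<lambda>n. 2 * q * n)" using q by (intro strict_monoI) simp
    show "((\<lambda>N. (real q * L - - (real q * L)) / real N *
        (\<Sum>i<N. g (- (real q * L) + real i * ((real q * L - - (real q * L)) / real N)))) \<circ>
          (\<lambda>n. 2 * q * n)) \<longlonglongrightarrow> integral {- (real q * L)..real q * L} g"
    proof (rule LIMSEQ_subseq_LIMSEQ[OF riemann_sums_tendsto_integral mono])
      show "continuous_on {- (real q * L)..real q * L} g"
        using cont_g continuous_on_subset by blast
      show "- (real q * L) \<le> real q * L" using L by simp
    qed
    show "\<forall>\<^sub>F n in sequentially. ((\<lambda>N. (real q * L - - (real q * L)) / real N *
        (\<Sum>i<N. g (- (real q * L) + real i * ((real q * L - - (real q * L)) / real N)))) \<circ>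
          (\<lambda>n. 2 * q * n)) n
        = L / real n * (\<Sum>d\<in>{-int (q * n)..int (q * n)}. g (of_int d * (L / real n)))"
      using eventually_gt_at_top[of 0]
    proof eventually_elim
      case (elim n)
      define h where "h = L / real n"
      have h: "(real q * L - - (real q * L)) / real (2 * q * n) = h" "real n * h = L"
        unfolding h_def using elim q by (auto simp: field_simps)
      have "g (of_int (int (q * n)) * h) = g (real q * L)" using h(2) by (simp add: mult.assoc)
      then have last: "g (of_int (int (q * n)) * h) = 0" using g_zero[of "real q * L"] L by simp
      define K where "K = q * n"
      have K: "2 * q * n = 2 * K" "real K * h = real q * L"
        unfolding K_def using h(2) by (auto simp: mult.assoc)
      have "{-int (q * n)..int (q * n)} = insert (int (q * n)) {-int (q * n)..<int (q * n)}"
        by auto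
      then have "(\<Sum>d\<in>{-int (q * n)..int (q * n)}. g (of_int d * h))
          = (\<Sum>d\<in>{-int (q * n)..<int (q * n)}. g (of_int d * h))"
        using last by simp
      also have "\<dots> = (\<Sum>i<2 * q * n. g (- (real q * L) + real i * h))"
        unfolding K(1) K(2)[symmetric] K_def[symmetric]
        by (rule sum.reindex_bij_witness[of _ "\<lambda>i. int i - int K" "\<lambda>d. nat (d + int K)"])
           (auto simp: algebra_simps)
      finally show ?case unfolding comp_def h(1) by (simp add: h_def)
    qed
  qed
  have "(\<lambda>n. real m * (L / real n * (\<Sum>d\<in>{-int (q * n)..int (q * n)}. g (of_int d * (L / real n)))))
      \<longlonglongrightarrow> real m * Re (LINT x|lborel. f x)"
    unfolding int_eq by (intro tendsto_mult_left lim)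
  moreover have "\<forall>\<^sub>F n in sequentially.
      real m * (L / real n * (\<Sum>d\<in>{-int (q * n)..int (q * n)}. g (of_int d * (L / real n)))) \<le> L"
    using pack eventually_gt_at_top[of 0]
  proof eventually_elim
    case (elim n)
    define h where "h = L / real n"
    define c where "c d = g (of_int d * h)" for d
    have h: "h > 0" "real n * h = L" unfolding h_def using elim L by auto
    obtain F where F: "F \<subseteq> {0..<int n}" "card F = m"
      and F': "\<And>x y. x mod int n \<in> F \<Longrightarrow> y mod int n \<in> F \<Longrightarrow> x \<noteq> y \<Longrightarrow>
         of_int (x - y) * h \<notin> \<Omega>"
      using elim unfolding h_def by blast
    have "real (card F) * (\<Sum>d\<in>{-int (q * n)..int (q * n)}. c d) \<le> real n * c 0"
    proof (rule packing_bound_sequence)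
      show "0 \<le> (\<Sum>j<N. \<Sum>k<N. v j * v k * c (int j - int k))" for N v
        using positive_definite_real_form[OF pd, where x = "\<lambda>j. real j * h" and v = v and m = N]
        by (simp add: c_def g_def left_diff_distrib)
      show "c d = 0" if "int (q * n) < \<bar>d\<bar>" for d
      proof -
        have "real (q * n) * h \<le> \<bar>real_of_int d\<bar> * h"
          using that h by (intro mult_right_mono) linarith+
        then show ?thesis unfolding c_def using h
          by (intro g_zero) (simp add: abs_mult mult.assoc)
      qed
      show "F \<subseteq> {0..<int n}" by fact
      show "F \<noteq> {}" using F m by auto
      show "c (x - y) = 0" if "x mod int n \<in> F" "y mod int n \<in> F" "x \<noteq> y" for x y
        unfolding c_def g_def using f_zero[OF F'[OF that]] by simp
    qed
    then have "h * (real m * (\<Sum>d\<in>{-int (q * n)..int (q * n)}. c d)) \<le> h * real n"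
      using h F by (simp add: c_def g_def f0)
    then show ?case using h by (simp add: c_def h_def mult_ac)
  qed
  ultimately have "real m * Re (LINT x|lborel. f x) \<le> L"
    by (intro tendsto_upperbound) auto
  then show ?thesis using m by (simp add: field_simps)
qed

section \<open>Upper bounds for the Turan problem\<close>

lemma turan_integral_le_interval:
  assumes adm: "turan_admissible \<Omega> f" and L: "0 < L" and sub: "\<Omega> \<subseteq> {-L<..<L}"
  shows "Re (LINT x|lborel. f x) \<le> L"
proof -
  have "Re (LINT x|lborel. f x) \<le> L / real 1"
  proof (rule turan_integral_le_packing[OF adm sub L])
    show "\<forall>\<^sub>F n in sequentially. \<exists>F. F \<subseteq> {0..<int n} \<and> card F = 1 \<and>
      (\<forall>x y. x mod int n \<in> F \<longrightarrow> y mod int n \<in> F \<longrightarrow> x \<noteq> y \<longrightarrow>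
         of_int (x - y) * (L / real n) \<notin> \<Omega>)"
      using eventually_gt_at_top[of 0]
    proof eventually_elim
      case (elim n)
      have "of_int (x - y) * (L / real n) \<notin> \<Omega>"
        if "x mod int n = 0" "y mod int n = 0" "x \<noteq> y" for x y :: int
      proof -
        have "int n dvd x - y" using that by (auto intro: dvd_diff)
        then obtain j where j: "x - y = int n * j" by (elim dvdE)
        then have "j \<noteq> 0" using that by auto
        then have "1 \<le> \<bar>real_of_int j\<bar>" by linarith
        then have "L \<le> \<bar>real_of_int j * L\<bar>" using L by (simp add: abs_mult)
        then show ?thesis using sub elim unfolding j by (fastforce simp: mult.commute)
      qed
      then show ?case using elim by (intro exI[of _ "{0}"]) auto
    qed
  qed simp
  then show ?thesis by simp
qed

lemma not_in_OmegaI: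
  assumes "1 \<le> \<bar>x\<bar>" "\<bar>x\<bar> \<le> t - 1 \<or> t + 1 \<le> \<bar>x\<bar>" "t \<ge> 0"
  shows "x \<notin> Omega t"
  using assms unfolding Omega_def by auto

text \<open>
  The packing is \<open>{0, s} + 2t\<int>\<close> with \<open>1 \<le> s \<le> t - 1\<close>. Differences within a pair fall into the gap
  \<open>[1, t - 1]\<close> of \<open>Omega t\<close>, and all others are at least \<open>2t - (t - 1) = t + 1\<close> in
  absolute value. Two points per period \<open>2t\<close> give the bound \<open>t\<close>. Since \<open>t > 2\<close>, an admissible \<open>s\<close>
  exists on every sufficiently fine grid.
\<close>

lemma turan_integral_le_gap:
  assumes adm: "turan_admissible (Omega t) f" and t: "2 < t"
  shows "Re (LINT x|lborel. f x) \<le> t"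
proof -
  have "Re (LINT x|lborel. f x) \<le> (2 * t) / real 2"
  proof (rule turan_integral_le_packing[OF adm, where R = "t + 1"])
    show "Omega t \<subseteq> {-(t + 1)<..<t + 1}" unfolding Omega_def using t by auto
    obtain n0 :: nat where n0: "2 * t / (t - 2) < real n0" using reals_Archimedean2 by blast
    show "\<forall>\<^sub>F n in sequentially. \<exists>F. F \<subseteq> {0..<int n} \<and> card F = 2 \<and>
      (\<forall>x y. x mod int n \<in> F \<longrightarrow> y mod int n \<in> F \<longrightarrow> x \<noteq> y \<longrightarrow>
         of_int (x - y) * (2 * t / real n) \<notin> Omega t)"
      using eventually_ge_at_top[of "Suc n0"]
    proof eventually_elim
      case (elim n)
      define h where "h = 2 * t / real n"
      have n: "real n > 0" "2 * t / (t - 2) < real n" using elim n0 by linarith+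
      have h: "0 < h" "h < t - 2" "real n * h = 2 * t"
        unfolding h_def using n t by (auto simp: field_simps)
      \<comment> \<open>The first grid point at distance at least 1 from the origin; it exceeds 1 by less than
        the mesh, which is smaller than the length \<open>t - 2\<close> of the gap.\<close>
      define p where "p = \<lceil>1 / h\<rceil>"
      have "1 / h \<le> of_int p" "of_int p < 1 / h + 1" unfolding p_def by linarith+
      then have ph: "1 \<le> of_int p * h" "of_int p * h \<le> t - 1"
        using h(1,2) by (auto simp: field_simps)
      have "p > 0" unfolding p_def using h by simp
      have "of_int p * h < real n * h" using ph h(3) t by linarith
      then have "p < int n" using h(1) by simp
      have "of_int (x - y) * h \<notin> Omega t"
        if "x mod int n \<in> {0, p}" "y mod int n \<in> {0, p}" "x \<noteq> y" for x y :: int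
      proof -
        define s where "s = x mod int n - y mod int n"
        define j where "j = x div int n - y div int n"
        have xy: "x - y = j * int n + s" unfolding s_def j_def
          using div_mult_mod_eq[of x "int n"] div_mult_mod_eq[of y "int n"]
          by (simp add: algebra_simps)
        have s: "s \<in> {0, p, -p}" using that unfolding s_def by auto
        have eq: "of_int (x - y) * h = of_int j * (2 * t) + of_int s * h"
          unfolding xy h(3)[symmetric] by (simp add: algebra_simps)
        have sh: "\<bar>of_int s * h\<bar> \<le> t - 1" "s \<noteq> 0 \<Longrightarrow> 1 \<le> \<bar>of_int s * h\<bar>"
          using s ph t by auto
        show ?thesis
        proof (cases "j = 0")
          case True
          then have "s \<noteq> 0" using xy that by auto
          then show ?thesis unfolding eq using True sh t by (intro not_in_OmegaI) auto
        next
          case False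
          then have "1 \<le> \<bar>real_of_int j\<bar>" by linarith
          then have "1 * (2 * t) \<le> \<bar>real_of_int j\<bar> * (2 * t)" using t by (intro mult_right_mono) auto
          then have "2 * t \<le> \<bar>of_int j * (2 * t)\<bar>" using t by (simp add: abs_mult)
          then have "t + 1 \<le> \<bar>of_int (x - y) * h\<bar>" unfolding eq using sh(1) by linarith
          then show ?thesis using t by (intro not_in_OmegaI) auto
        qed
      qed
      then show ?case unfolding h_def[symmetric] using \<open>p > 0\<close> \<open>p < int n\<close>
        by (intro exI[of _ "{0, p}"]) auto
    qed
  qed (use t in auto)
  then show ?thesis by simp
qed

section \<open>Triangle functions\<close>

definition triangle :: "real \<Rightarrow> real \<Rightarrow> real" where
  "triangle r x = max 0 (1 - \<bar>x\<bar> / r)"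

lemma triangle_eq_0_iff: "0 < r \<Longrightarrow> triangle r x = 0 \<longleftrightarrow> r \<le> \<bar>x\<bar>"
  unfolding triangle_def by (auto simp: max_def field_simps)

lemma triangle_0: "triangle r 0 = 1"
  by (simp add: triangle_def)

lemma continuous_on_triangle:
  "continuous_on A f \<Longrightarrow> continuous_on A (\<lambda>x. triangle r (f x))"
  unfolding triangle_def divide_inverse by (intro continuous_intros)

text \<open>
  The overlap of two intervals of length \<open>r\<close> depends only on the distance of their endpoints.
  This exhibits the triangle as an autocorrelation, hence as positive definite.
\<close>

lemma triangle_eq_overlap:
  assumes "0 < r"
  shows "triangle r (a - b) = (LINT s|lborel. indicator {a..a+r} s * indicator {b..b+r} s) / r"
proof -
  have "(LINT s|lborel. indicator {a..a+r} s * indicator {b..b+r} s)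
      = (LINT s|lborel. indicator {max a b..min a b + r} s :: real)"
    by (intro Bochner_Integration.integral_cong refl) (auto simp: indicator_def)
  also have "\<dots> = max 0 (r - \<bar>a - b\<bar>)"
    by (auto simp: max_def min_def)
  finally show ?thesis using assms unfolding triangle_def by (auto simp: max_def field_simps)
qed

lemma positive_definite_triangle:
  assumes r: "0 < r"
  shows "positive_definite (\<lambda>x. complex_of_real (triangle r x))"
  unfolding positive_definite_def
proof (intro allI)
  fix m :: nat and x :: "nat \<Rightarrow> real" and z :: "nat \<Rightarrow> complex"
  define w where "w j s = (indicator {x j..x j + r} s :: real)" for j s
  have w_int: "integrable lborel (\<lambda>s. w j s * w k s)" for j k
  proof -
    have "w j s * w k s = indicator ({x j..x j + r} \<inter> {x k..x k + r}) s" for s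
      unfolding w_def by (rule indicator_inter_arith[symmetric])
    then show ?thesis by (simp add: integrable_indicator_iff emeasure_lborel_Icc_eq)
  qed
  have "(\<Sum>j<m. \<Sum>k<m. z j * cnj (z k) * complex_of_real (triangle r (x j - x k)))
      = (\<Sum>j<m. \<Sum>k<m. z j * cnj (z k) * (LINT s|lborel. complex_of_real (w j s * w k s))) / r"
    unfolding triangle_eq_overlap[OF r] w_def sum_divide_distrib integral_complex_of_real by simp
  also have "(\<Sum>j<m. \<Sum>k<m. z j * cnj (z k) * (LINT s|lborel. complex_of_real (w j s * w k s)))
      = (LINT s|lborel. (\<Sum>j<m. \<Sum>k<m. z j * cnj (z k) * complex_of_real (w j s * w k s)))"
    using w_int by (simp add: Bochner_Integration.integral_sum del: of_real_mult)
  also have "\<dots> = (LINT s|lborel. complex_of_real ((cmod (\<Sum>j<m. z j * w j s))\<^sup>2))"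
    by (intro Bochner_Integration.integral_cong refl)
       (simp add: complex_norm_square sum_product mult_ac del: of_real_power)
  also have "\<dots> / r = complex_of_real ((LINT s|lborel. (cmod (\<Sum>j<m. z j * w j s))\<^sup>2) / r)"
    unfolding integral_complex_of_real by simp
  finally show "(\<Sum>j<m. \<Sum>k<m. z j * cnj (z k) * complex_of_real (triangle r (x j - x k))) \<in> \<real>\<^sub>\<ge>\<^sub>0"
    using r by (simp only: nonneg_Reals_of_real_iff) (simp add: Bochner_Integration.integral_nonneg)
qed

lemma has_integral_triangle:
  assumes r: "0 < r"
  shows "(triangle r has_integral r) {-r..r}"
proof -
  have "(triangle r has_integral (\<lambda>x. x + x\<^sup>2 / (2 * r)) 0 - (\<lambda>x. x + x\<^sup>2 / (2 * r)) (-r)) {-r..0}"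
    using r by (intro fundamental_theorem_of_calculus)
      (auto simp: triangle_def max_def field_simps has_real_derivative_iff_has_vector_derivative[symmetric]
        intro!: derivative_eq_intros)
  moreover have "(triangle r has_integral (\<lambda>x. x - x\<^sup>2 / (2 * r)) r - (\<lambda>x. x - x\<^sup>2 / (2 * r)) 0) {0..r}"
    using r by (intro fundamental_theorem_of_calculus)
      (auto simp: triangle_def max_def field_simps has_real_derivative_iff_has_vector_derivative[symmetric]
        intro!: derivative_eq_intros)
  ultimately have "(triangle r has_integral
      ((\<lambda>x. x + x\<^sup>2 / (2 * r)) 0 - (\<lambda>x. x + x\<^sup>2 / (2 * r)) (-r)) +
      ((\<lambda>x. x - x\<^sup>2 / (2 * r)) r - (\<lambda>x. x - x\<^sup>2 / (2 * r)) 0)) {-r..r}"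
    using r by (intro has_integral_combine[of "-r" 0 r]) auto
  moreover have "((\<lambda>x. x + x\<^sup>2 / (2 * r)) 0 - (\<lambda>x. x + x\<^sup>2 / (2 * r)) (-r)) +
      ((\<lambda>x. x - x\<^sup>2 / (2 * r)) r - (\<lambda>x. x - x\<^sup>2 / (2 * r)) 0) = r"
    using r by (simp add: power2_eq_square field_simps)
  ultimately show ?thesis by simp
qed

lemma lborel_integral_triangle:
  assumes r: "0 < r"
  shows "integrable lborel (\<lambda>x. triangle r (x - t))" "(LINT x|lborel. triangle r (x - t)) = r"
proof -
  have cont: "continuous_on UNIV (triangle r)" by (rule continuous_on_triangle[OF continuous_on_id])
  have zero: "triangle r x = 0" if "x \<notin> {-r..r}" for x
  proof -
    have "r \<le> \<bar>x\<bar>" using that by auto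
    then show ?thesis using triangle_eq_0_iff[OF r] by blast
  qed
  note tri = compactly_supported_lborel[OF cont zero, of "-r" r]
  show "integrable lborel (\<lambda>x. triangle r (x - t))"
    using lborel_integrable_real_affine[OF tri(1), of 1 "-t"] by simp
  show "(LINT x|lborel. triangle r (x - t)) = r"
    using lborel_integral_real_affine[of 1 "triangle r" "-t"] tri(2)
      integral_unique[OF has_integral_triangle[OF r]] by simp
qed

text \<open>
  The new function is half the sum of the \<open>f(x + a - b)\<close> over \<open>a\<close> and \<open>b\<close> in \<open>{0, t}\<close>. Its form at
  \<open>m\<close> points is therefore half the form of \<open>f\<close> at these points together with their translates
  by \<open>t\<close>, each translate carrying the coefficient of the original.
\<close>

lemma positive_definite_add_translates:
  assumes "positive_definite f"
  shows "positive_definite (\<lambda>x. f x + (f (x - t) + f (x + t)) / 2)"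
  unfolding positive_definite_def
proof (intro allI)
  fix m :: nat and x :: "nat \<Rightarrow> real" and z :: "nat \<Rightarrow> complex"
  define x' where "x' i = (if i < m then x i else x (i - m) + t)" for i
  define z' where "z' i = (if i < m then z i else z (i - m))" for i
  define S where "S = (\<Sum>j<m + m. \<Sum>k<m + m. z' j * cnj (z' k) * f (x' j - x' k))"
  have "(\<Sum>i<m + n. h i) = (\<Sum>i<m. h i) + (\<Sum>i<n. h (m + i))" for h :: "nat \<Rightarrow> complex" and n
    by (induction n) (simp_all add: add.assoc)
  note split = this[where n = m]
  have "S \<in> \<real>\<^sub>\<ge>\<^sub>0" using assms unfolding S_def positive_definite_def by blast
  then have "S / of_real 2 \<in> \<real>\<^sub>\<ge>\<^sub>0" using nonneg_Reals_divide_I by (metis nonneg_Reals_of_real_iff zero_le_numeral)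
  moreover have "S / of_real 2 = (\<Sum>j<m. \<Sum>k<m. z j * cnj (z k) *
      (f (x j - x k) + (f (x j - x k - t) + f (x j - x k + t)) / 2))"
    unfolding S_def split sum.distrib[symmetric] sum_divide_distrib
    by (intro sum.cong refl) (simp add: x'_def z'_def algebra_simps add_divide_distrib)
  ultimately show "(\<Sum>j<m. \<Sum>k<m. z j * cnj (z k) *
      (f (x j - x k) + (f (x j - x k - t) + f (x j - x k + t)) / 2)) \<in> \<real>\<^sub>\<ge>\<^sub>0"
    by simp
qed

section \<open>The Turan constants on both sides of the jump\<close>

text \<open>
  The lower bound is only approached: supports must be compact subsets of the open set
  \<open>\<Omega>\<close>, so the extremal triangles have to be shrunk by a factor \<open>r < 1\<close>.
\<close>

lemma turan_constant_bounds:
  assumes ub: "\<And>f. turan_admissible \<Omega> f \<Longrightarrow> Re (LINT x|lborel. f x) \<le> B"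
    and lb: "\<And>r. 0 < r \<Longrightarrow> r < 1 \<Longrightarrow> \<exists>f. turan_admissible \<Omega> f \<and> Re (LINT x|lborel. f x) = A * r"
  shows "A \<le> turan_constant \<Omega>" "turan_constant \<Omega> \<le> B"
proof -
  let ?S = "{Re (LINT x|lborel. f x) | f. turan_admissible \<Omega> f}"
  have bdd: "bdd_above ?S" using ub by (auto intro!: bdd_aboveI[of _ B])
  have "?S \<noteq> {}" using lb[of "1/2"] by auto
  then show "turan_constant \<Omega> \<le> B" unfolding turan_constant_def using ub by (intro cSup_least) auto
  have "\<forall>\<^sub>F r in at_left 1. A * r \<le> turan_constant \<Omega>"
    using eventually_at_left_real[of 0 "1::real"]
  proof (rule eventually_mono)
    fix r :: real assume "r \<in> {0<..<1}"
    then obtain f where "turan_admissible \<Omega> f" "Re (LINT x|lborel. f x) = A * r"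
      using lb[of r] by auto
    then have "A * r \<in> ?S" by force
    then show "A * r \<le> turan_constant \<Omega>" unfolding turan_constant_def
      using bdd by (rule cSup_upper)
  qed simp
  moreover have "((\<lambda>r. A * r) \<longlongrightarrow> A * 1) (at_left 1)" by (intro tendsto_intros)
  ultimately have "A * 1 \<le> turan_constant \<Omega>" by (intro tendsto_upperbound) auto
  then show "A \<le> turan_constant \<Omega>" by simp
qed

lemma turan_constant_Omega_below:
  assumes t: "0 \<le> t" "t < 2"
  shows "turan_constant (Omega t) = 1 + t"
proof (rule antisym)
  have ub: "Re (LINT x|lborel. f x) \<le> 1 + t" if "turan_admissible (Omega t) f" for f
    using turan_integral_le_interval[OF that, of "1 + t"] t unfolding Omega_def by force
  have lb: "\<exists>f. turan_admissible (Omega t) f \<and> Re (LINT x|lborel. f x) = (1 + t) * r"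
    if r: "0 < r" "r < 1" for r
  proof (intro exI conjI)
    define R where "R = (1 + t) * r"
    have R: "0 < R" "R < 1 + t" unfolding R_def using r t by auto
    let ?f = "\<lambda>x. complex_of_real (triangle R x)"
    have "closure {x. ?f x \<noteq> 0} \<subseteq> {-R..R}"
      by (rule closure_minimal) (auto simp: triangle_eq_0_iff[OF R(1)])
    also have "\<dots> \<subseteq> Omega t" using R t unfolding Omega_def by auto
    finally have supp: "closure {x. ?f x \<noteq> 0} \<subseteq> Omega t" .
    have "continuous_on UNIV ?f"
      by (intro continuous_on_of_real continuous_on_triangle continuous_on_id)
    then show "turan_admissible (Omega t) ?f" unfolding turan_admissible_def
      using positive_definite_triangle[OF R(1)] supp triangle_0[of R] by simp
    show "Re (LINT x|lborel. ?f x) = (1 + t) * r"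
      using lborel_integral_triangle(2)[OF R(1), of 0] by (simp add: R_def)
  qed
  show "turan_constant (Omega t) \<le> 1 + t" "1 + t \<le> turan_constant (Omega t)"
    using turan_constant_bounds[OF ub lb] by auto
qed

lemma turan_constant_Omega_above:
  assumes t: "2 < t"
  shows "2 \<le> turan_constant (Omega t)" "turan_constant (Omega t) \<le> t"
proof -
  have lb: "\<exists>f. turan_admissible (Omega t) f \<and> Re (LINT x|lborel. f x) = 2 * r"
    if r: "0 < r" "r < 1" for r
  proof (intro exI conjI)
    let ?g = "\<lambda>x. triangle r x + (triangle r (x - t) + triangle r (x + t)) / 2"
    let ?f = "\<lambda>x. complex_of_real (?g x)"
    have "closure {x. ?f x \<noteq> 0} \<subseteq> {-r..r} \<union> {t - r..t + r} \<union> {-t - r..-t + r}"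
    proof (rule closure_minimal)
      show "{x. ?f x \<noteq> 0} \<subseteq> {-r..r} \<union> {t - r..t + r} \<union> {-t - r..-t + r}"
      proof
        fix x assume "x \<in> {x. ?f x \<noteq> 0}"
        then have "triangle r x \<noteq> 0 \<or> triangle r (x - t) \<noteq> 0 \<or> triangle r (x + t) \<noteq> 0" by auto
        then show "x \<in> {-r..r} \<union> {t - r..t + r} \<union> {-t - r..-t + r}"
          unfolding triangle_eq_0_iff[OF r(1)] by auto
      qed
    qed (intro closed_Un closed_atLeastAtMost)
    also have "\<dots> \<subseteq> Omega t" using r unfolding Omega_def by auto
    finally have supp: "closure {x. ?f x \<noteq> 0} \<subseteq> Omega t" .
    have "positive_definite ?f"
      using positive_definite_add_translates[OF positive_definite_triangle[OF r(1)], of t] by simp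
    moreover have "?f 0 = 1"
      using triangle_eq_0_iff[OF r(1), of t] triangle_eq_0_iff[OF r(1), of "-t"] r t
      by (simp add: triangle_0)
    moreover have "continuous_on UNIV ?f"
      by (intro continuous_on_of_real continuous_on_triangle continuous_on_add continuous_on_divide
          continuous_on_diff continuous_on_id continuous_on_const) auto
    ultimately show "turan_admissible (Omega t) ?f" using supp unfolding turan_admissible_def by blast
    have "Re (LINT x|lborel. ?f x) = (LINT x|lborel. ?g x)"
      unfolding integral_complex_of_real by simp
    also have "\<dots> = 2 * r"
      using lborel_integral_triangle[OF r(1), of 0] lborel_integral_triangle[OF r(1), of t]
        lborel_integral_triangle[OF r(1), of "-t"] by simp
    finally show "Re (LINT x|lborel. ?f x) = 2 * r" .
  qed
  show "2 \<le> turan_constant (Omega t)" "turan_constant (Omega t) \<le> t"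
    using turan_constant_bounds[OF turan_integral_le_gap[OF _ t] lb] by auto
qed

theorem proposition5p2:
  shows "((\<lambda>t. turan_constant (Omega t)) \<longlongrightarrow> 2) (at_right 2)
       \<and> (2::real) < 3
       \<and> ((\<lambda>t. turan_constant (Omega t)) \<longlongrightarrow> 3) (at_left 2)
       \<and> \<not> continuous (at 2 within {0..}) (\<lambda>t. turan_constant (Omega t))"
proof -
  let ?T = "\<lambda>t. turan_constant (Omega t)"
  have right: "(?T \<longlongrightarrow> 2) (at_right 2)"
  proof (rule tendsto_sandwich[where f = "\<lambda>_. 2" and h = "\<lambda>t. t"])
    show "\<forall>\<^sub>F t in at_right 2. 2 \<le> ?T t" "\<forall>\<^sub>F t in at_right 2. ?T t \<le> t"
      using turan_constant_Omega_above
      by (auto simp: eventually_at_filter)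
  qed (auto intro: tendsto_intros)
  have left: "(?T \<longlongrightarrow> 3) (at_left 2)"
  proof (rule Lim_transform_eventually)
    show "((\<lambda>t::real. 1 + t) \<longlongrightarrow> 3) (at_left 2)" by (auto intro!: tendsto_eq_intros)
    show "\<forall>\<^sub>F t in at_left 2. 1 + t = ?T t"
      using eventually_at_left_real[of 0 "2::real", simplified]
      by eventually_elim (simp add: turan_constant_Omega_below)
  qed
  have "\<not> continuous (at 2 within {0..}) ?T"
  proof
    assume "continuous (at 2 within {0..}) ?T"
    then have lim: "(?T \<longlongrightarrow> ?T 2) (at 2 within {0..})" by (simp add: continuous_within)
    have "(?T \<longlongrightarrow> ?T 2) (at_right 2)" by (rule tendsto_within_subset[OF lim]) auto
    then have two: "?T 2 = 2" using right by (intro tendsto_unique[of "at_right 2"]) auto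
    have "at_left 2 = at 2 within {0..<2::real}"
      by (rule at_within_nhd[of _ "{0<..}"]) auto
    moreover have "{0..<2} \<subseteq> {0::real..}" by auto
    note tendsto_within_subset[OF lim this]
    ultimately have "(?T \<longlongrightarrow> ?T 2) (at_left 2)" by simp
    then have "?T 2 = 3" using left by (intro tendsto_unique[of "at_left 2"]) auto
    then show False using two by simp
  qed
  then show ?thesis using right left by simp
qed

end
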